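(* Let $R=\mathsf{k}[x_1,\ldots,x_d]$ with $d\ge1$, where $\mathsf{k}$ is a field of characteristic $0$. There does not exist a polynomial function $p:\mathbb{N}\to\mathbb{N}$ such that $I^{\langle p(n)\rangle}\subseteq I^n$ for all ideals $I\subseteq R$ and all $n\in\mathbb{Z}_{\ge0}$.
   Context: Here $\mathbb{N}=\mathbb{Z}_{\ge0}$. For a commutative $\mathsf{k}$-algebra $R$ and $P,Q\in\operatorname{End}_{\mathsf{k}}(R)$, put $[P,Q]=P\cdot Q-Q\cdot P$. Identify $a\in R$ with the endomorphism "multiplication by $a$". Let $D^0_{\mathsf{k}}(R)\subseteq \operatorname{End}_{\mathsf{k}}(R)$ be the set of multiplications by elements of $R$, and for $i>0$ let $D^i_{\mathsf{k}}(R)=\{\partial\in\operatorname{End}_{\mathsf{k}}(R)\mid [\partial,a]\in D^{i-1}_{\mathsf{k}}(R)\text{ for all }a\in R\}$. For an ideal $I\subseteq R$ and a positive integer $n$, the $n$-th differential power of $I$ is the ideal $I^{\langle n\rangle}=\{r\in R\mid \partial(r)\in I\text{ for all }\partial\in D^{n-1}_{\mathsf{k}}(R)\}$, with the convention $I^{\langle0\rangle}=R$; $I^n$ is the ordinary power, with $I^0=R$. *)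

theory Defs
  imports
    Complex_Main
    "HOL-Library.Poly_Mapping"
    "HOL-Computational_Algebra.Polynomial"
begin

text \<open>
  The polynomial ring over \<open>'k\<close> in variables indexed by the finite type \<open>'n\<close>, i.e. in
  \<open>d = CARD('n)\<close> variables (so \<open>d \<ge> 1\<close>).  A monomial is its exponent vector \<open>'n \<Rightarrow>\<^sub>0 nat\<close>; the
  multiplication of \<^theory>\<open>HOL-Library.Poly_Mapping\<close> is convolution, that is, polynomial
  multiplication.
\<close>

type_synonym ('n, 'k) mpoly = "('n \<Rightarrow>\<^sub>0 nat) \<Rightarrow>\<^sub>0 'k"

definition mpoly_scale :: "'k::comm_ring_1 \<Rightarrow> ('n, 'k) mpoly \<Rightarrow> ('n, 'k) mpoly"
  where "mpoly_scale c f = Poly_Mapping.single 0 c * f"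

text \<open>
  For a commutative algebra \<open>'r\<close> over \<open>'k\<close>, the algebra structure is passed as its scalar
  multiplication \<open>s :: 'k \<Rightarrow> 'r \<Rightarrow> 'r\<close>, and the elements of \<open>End\<^sub>k(R)\<close> are the functions \<open>P\<close> with
  \<open>module_hom s s P\<close>.
\<close>

definition commutator :: "('r \<Rightarrow> 'r) \<Rightarrow> ('r \<Rightarrow> 'r) \<Rightarrow> 'r \<Rightarrow> 'r::ab_group_add"
  where "commutator P Q = (\<lambda>r. (P \<circ> Q) r - (Q \<circ> P) r)"

primrec diff_ops ::
  "('k::comm_ring_1 \<Rightarrow> 'r::comm_ring_1 \<Rightarrow> 'r) \<Rightarrow> nat \<Rightarrow> ('r \<Rightarrow> 'r) set"
  where
    "diff_ops s 0 = range (\<lambda>a. (*) a)"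
  | "diff_ops s (Suc i) =
      {D. module_hom s s D \<and> (\<forall>a. commutator D ((*) a) \<in> diff_ops s i)}"

definition diff_power ::
  "('k::comm_ring_1 \<Rightarrow> 'r::comm_ring_1 \<Rightarrow> 'r) \<Rightarrow> 'r set \<Rightarrow> nat \<Rightarrow> 'r set"
  where "diff_power s I n =
    (if n = 0 then UNIV else {r. \<forall>D\<in>diff_ops s (n - 1). D r \<in> I})"

text \<open>Ideals of a commutative ring are the submodules of the ring over itself.\<close>

abbreviation is_ideal :: "'r::comm_ring_1 set \<Rightarrow> bool"
  where "is_ideal I \<equiv> module.subspace (*) I"

definition ideal_mult :: "'r::comm_ring_1 set \<Rightarrow> 'r set \<Rightarrow> 'r set"
  where "ideal_mult I J = module.span (*) {a * b | a b. a \<in> I \<and> b \<in> J}"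

primrec ideal_power :: "'r::comm_ring_1 set \<Rightarrow> nat \<Rightarrow> 'r set"
  where
    "ideal_power I 0 = UNIV"
  | "ideal_power I (Suc n) = ideal_mult I (ideal_power I n)"

text \<open>
  The values are required to be natural numbers, but not the coefficients: for instance
  \<open>n (n + 1) / 2\<close> is a polynomial function.
\<close>

definition nat_polynomial_function :: "(nat \<Rightarrow> nat) \<Rightarrow> bool"
  where "nat_polynomial_function p \<longleftrightarrow> (\<exists>q :: real poly. \<forall>n. real (p n) = poly q (real n))"

lemma module_mpoly_scale: "module (mpoly_scale :: 'k::comm_ring_1 \<Rightarrow> ('n, 'k) mpoly \<Rightarrow> _)"
proof
  fix a b :: 'k and x y :: "('n, 'k) mpoly"
  show "mpoly_scale a (x + y) = mpoly_scale a x + mpoly_scale a y"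
    by (simp add: mpoly_scale_def distrib_left)
  show "mpoly_scale (a + b) x = mpoly_scale a x + mpoly_scale b x"
    by (simp add: mpoly_scale_def single_add distrib_right)
  show "mpoly_scale a (mpoly_scale b x) = mpoly_scale (a * b) x"
    by (simp add: mpoly_scale_def mult_single flip: mult.assoc)
  show "mpoly_scale 1 x = x"
    by (simp add: mpoly_scale_def)
qed

lemma mult_module_hom_mpoly_scale: "module_hom mpoly_scale mpoly_scale ((*) (a :: ('n, 'k::comm_ring_1) mpoly))"
proof (intro module_hom.intro module_mpoly_scale, unfold_locales)
  fix c :: 'k and x y :: "('n, 'k) mpoly"
  show "a * (x + y) = a * x + a * y"
    by (simp add: distrib_left)
  show "a * mpoly_scale c x = mpoly_scale c (a * x)"
    by (simp add: mpoly_scale_def mult.left_commute)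
qed

lemma module_ring_self: "module ((*) :: 'r::comm_ring_1 \<Rightarrow> 'r \<Rightarrow> 'r)"
  by unfold_locales (simp_all add: distrib_left distrib_right mult.assoc)

lemma is_ideal_ideal_power: "is_ideal (ideal_power I n)"
  by (cases n)
    (simp_all add: ideal_mult_def module.subspace_UNIV module.subspace_span module_ring_self)

end

theory Submission
  imports Defs
begin

text \<open>
  A differential operator of order \<open>i\<close> lowers the order of vanishing along a hypersurface
  \<open>x = 0\<close> by at most \<open>i\<close>, whatever that order was (\<open>diff_ops_power_dvd\<close>).  So for
  \<open>I = (x\<^sup>m)\<close> the power \<open>x\<^bsup>m + N\<^esup>\<close> lies in the \<open>N\<close>-th differential power: passing from
  \<open>I\<close> to a differential power costs an additive amount that does not depend on \<open>m\<close>.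
  Passing to \<open>I\<^sup>2 = (x\<^bsup>2 m\<^esup>)\<close>, by contrast, doubles the exponent.  The exponent \<open>n = 2\<close>
  is thus fatal already: \<open>N = p 2\<close> is one fixed number, and for a coordinate \<open>x\<close> and \<open>m > N\<close> the
  element \<open>x\<^bsup>m + N\<^esup>\<close> is in the differential power but not divisible by \<open>x\<^bsup>2 m\<^esup>\<close>.
\<close>

text \<open>
  The identity \<open>D (x y) = x D y + [D, x] y\<close> removes one factor \<open>x\<close> from the argument; in
  the first summand that factor reappears outside, in the second the order of the operator drops.
\<close>

lemma diff_ops_power_dvd:
  assumes "D \<in> diff_ops s i"
  shows "x ^ k dvd D (x ^ (k + i) * r)"
  using assms
proof (induction i arbitrary: D k r)
  case 0
  then show ?case
    by auto
next
  case order: (Suc i)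
  show ?case
  proof (induction k arbitrary: r)
    case 0
    show ?case
      by simp
  next
    case (Suc k)
    let ?y = "x ^ (k + Suc i) * r"
    let ?C = "commutator D ((*) x)"
    have "x * x ^ k dvd x * D ?y"
      by (rule mult_dvd_mono[OF dvd_refl Suc.IH])
    moreover have "x ^ Suc k dvd ?C (x ^ (Suc k + i) * r)"
      using order.prems by (intro order.IH) simp
    ultimately have "x ^ Suc k dvd x * D ?y + ?C ?y"
      by simp
    moreover have "D (x ^ (Suc k + Suc i) * r) = x * D ?y + ?C ?y"
      by (simp add: commutator_def mult.assoc)
    ultimately show ?case
      by simp
  qed
qed

lemma is_ideal_multiples: "is_ideal {f :: 'r::comm_ring_1. a dvd f}"
  by (auto simp: module.subspace_def[OF module_ring_self])

lemma power_in_diff_power_multiples: "x ^ (m + N) \<in> diff_power s {f. x ^ m dvd f} N"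
proof (cases N)
  case 0
  then show ?thesis
    by (simp add: diff_power_def)
next
  case (Suc i)
  \<comment> \<open>The \<open>N\<close>-th differential power only involves operators of order \<open>N - 1\<close>, so one factor
    \<open>x\<close> is left over.\<close>
  then have "x ^ (m + N) = x ^ (m + i) * x"
    by (simp add: mult.commute)
  with Suc show ?thesis
    by (simp only: diff_power_def) (auto intro: diff_ops_power_dvd)
qed

lemma ideal_power_multiples_subset: "ideal_power {f :: 'r::comm_ring_1. a dvd f} n \<subseteq> {f. a ^ n dvd f}"
proof (induction n)
  case 0
  show ?case
    by simp
next
  case (Suc n)
  show ?case
    unfolding ideal_power.simps ideal_mult_def
    using Suc by (intro module.span_minimal[OF module_ring_self] is_ideal_multiples) (auto intro: mult_dvd_mono)
qed

lemma power_single_variable: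
  "Poly_Mapping.single (Poly_Mapping.single i 1) 1 ^ n =
    (Poly_Mapping.single (Poly_Mapping.single i n) 1 :: ('n, 'k::comm_ring_1) mpoly)"
  by (induction n) (simp_all add: mult_single flip: single_add)

text \<open>
  Every monomial of a multiple of \<open>x ^ a\<close> has exponent at least \<open>a\<close> at \<open>i\<close>.
\<close>

lemma variable_power_dvd_imp_le:
  fixes i :: 'n
  defines "x \<equiv> (Poly_Mapping.single (Poly_Mapping.single i 1) 1 :: ('n, 'k::comm_ring_1) mpoly)"
  assumes "x ^ a dvd x ^ b"
  shows "a \<le> b"
proof -
  obtain g where "x ^ b = x ^ a * g"
    using assms(2) by (elim dvdE)
  then have g: "Poly_Mapping.single (Poly_Mapping.single i b) 1 =
      Poly_Mapping.single (Poly_Mapping.single i a) 1 * g"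
    by (simp only: x_def power_single_variable)
  have "Poly_Mapping.single i b \<in> Poly_Mapping.keys (Poly_Mapping.single (Poly_Mapping.single i b) 1 :: ('n, 'k) mpoly)"
    by simp
  then have "Poly_Mapping.single i b \<in> Poly_Mapping.keys (Poly_Mapping.single (Poly_Mapping.single i a) 1 * g)"
    by (simp only: g)
  then obtain e where "Poly_Mapping.single i b = Poly_Mapping.single i a + e"
    using keys_mult[of "Poly_Mapping.single (Poly_Mapping.single i a) 1" g] by auto
  then have "b = a + Poly_Mapping.lookup e i"
    by (metis lookup_add lookup_single_eq)
  then show ?thesis
    by simp
qed

theorem theorem5p3:
  shows "\<not> (\<exists>p :: nat \<Rightarrow> nat. nat_polynomial_function p \<and>
    (\<forall>(I :: ('n::finite, 'k::field_char_0) mpoly set) (n :: nat). is_ideal I \<longrightarrow>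
      diff_power mpoly_scale I (p n) \<subseteq> ideal_power I n))"
proof
  assume "\<exists>p :: nat \<Rightarrow> nat. nat_polynomial_function p \<and>
    (\<forall>(I :: ('n, 'k) mpoly set) (n :: nat). is_ideal I \<longrightarrow>
      diff_power mpoly_scale I (p n) \<subseteq> ideal_power I n)"
  then obtain p :: "nat \<Rightarrow> nat" where
    p: "\<And>(I :: ('n, 'k) mpoly set) n. is_ideal I \<Longrightarrow>
      diff_power mpoly_scale I (p n) \<subseteq> ideal_power I n"
    by blast
  define x :: "('n, 'k) mpoly"
    where "x = Poly_Mapping.single (Poly_Mapping.single undefined 1) 1"
  define m where "m = Suc (p 2)"
  let ?I = "{f. x ^ m dvd f}"
  have "x ^ (m + p 2) \<in> diff_power mpoly_scale ?I (p 2)"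
    by (rule power_in_diff_power_multiples)
  also have "\<dots> \<subseteq> ideal_power ?I 2"
    by (rule p) (rule is_ideal_multiples)
  also have "\<dots> \<subseteq> {f. (x ^ m) ^ 2 dvd f}"
    by (rule ideal_power_multiples_subset)
  finally have "x ^ (m * 2) dvd x ^ (m + p 2)"
    by (simp add: power_mult)
  then have "m * 2 \<le> m + p 2"
    unfolding x_def by (rule variable_power_dvd_imp_le)
  then show False
    by (simp add: m_def)
qed

end
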